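(* For every integer $N\geq 2$, the polynomial $$R_N(t)=\sum_{\pi\in\mathfrak S_N}t^{\#\{\text{descents of }\pi\text{ with even top}\}}$$ has only simple negative (real) zeros. Moreover, for every $N\geq 2$ the zeros of $R_N(t)$ and $R_{N+1}(t)$ strictly interlace.
   Context: $\mathfrak S_N$ is the symmetric group on $\{1,\dots,N\}$, with permutations in one-line notation $\pi=\pi_1\cdots\pi_N$. A descent with even top of $\pi$ is an index $1\leq i<N$ such that $\pi_i>\pi_{i+1}$ and $\pi_i$ is even. The zeros of two real-rooted polynomials strictly interlace if the polynomials have degrees differing by at most one, have only simple zeros and no common zero, and the zeros of the two polynomials alternate along the real line (in the increasing list of all zeros of both polynomials, neighbouring entries come from different polynomials). *)

theory Defs
  imports
    "HOL-Computational_Algebra.Computational_Algebra"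
    "HOL-Combinatorics.Permutations"
    Complex_Main
begin

text \<open>A permutation \<^term>\<open>\<pi>\<close> with \<^term>\<open>\<pi> permutes {1..N}\<close> has one-line notation
  \<^term>\<open>\<pi> 1\<close>, \dots, \<^term>\<open>\<pi> N\<close>.\<close>

definition even_top_descents :: "nat \<Rightarrow> (nat \<Rightarrow> nat) \<Rightarrow> nat set" where
  "even_top_descents N \<pi> = {i. 1 \<le> i \<and> i < N \<and> \<pi> i > \<pi> (i + 1) \<and> even (\<pi> i)}"

definition R :: "nat \<Rightarrow> real poly" where
  "R N = (\<Sum>\<pi> | \<pi> permutes {1..N}. monom 1 (card (even_top_descents N \<pi>)))"

text \<open>Zeros are taken over the complex numbers, so that claims about all zeros
  of a real polynomial are not claims about its real zeros only.\<close>

abbreviation complex_poly :: "real poly \<Rightarrow> complex poly" where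
  "complex_poly \<equiv> map_poly complex_of_real"

definition only_simple_negative_zeros :: "real poly \<Rightarrow> bool" where
  "only_simple_negative_zeros p \<longleftrightarrow> p \<noteq> 0 \<and>
     (\<forall>z. poly (complex_poly p) z = 0 \<longrightarrow>
        z \<in> \<real> \<and> Re z < 0 \<and> order z (complex_poly p) = 1)"

definition real_rooted :: "real poly \<Rightarrow> bool" where
  "real_rooted p \<longleftrightarrow> p \<noteq> 0 \<and> (\<forall>z. poly (complex_poly p) z = 0 \<longrightarrow> z \<in> \<real>)"

definition real_zeros :: "real poly \<Rightarrow> real set" where
  "real_zeros p = {x. poly p x = 0}"

definition alternating_zeros :: "real poly \<Rightarrow> real poly \<Rightarrow> bool" where
  "alternating_zeros p q \<longleftrightarrow>
     (let xs = sorted_list_of_set (real_zeros p \<union> real_zeros q) in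
        \<forall>i. Suc i < length xs \<longrightarrow>
          (xs ! i \<in> real_zeros p \<and> xs ! Suc i \<in> real_zeros q) \<or>
          (xs ! i \<in> real_zeros q \<and> xs ! Suc i \<in> real_zeros p))"

text \<open>The list of all zeros in \<^const>\<open>alternating_zeros\<close> is meaningful because
  \<^const>\<open>real_rooted\<close> excludes the zero polynomial, so the zero sets are finite.
  It lists each zero once, which loses nothing as the zeros are simple and
  not shared.\<close>

definition strictly_interlace :: "real poly \<Rightarrow> real poly \<Rightarrow> bool" where
  "strictly_interlace p q \<longleftrightarrow>
     real_rooted p \<and> real_rooted q \<and>
     degree p \<le> degree q + 1 \<and> degree q \<le> degree p + 1 \<and>
     (\<forall>x \<in> real_zeros p. order x p = 1) \<and> (\<forall>x \<in> real_zeros q. order x q = 1) \<and>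
     real_zeros p \<inter> real_zeros q = {} \<and>
     alternating_zeros p q"

end

theory Submission imports Defs begin

text \<open>Inserting the value \<open>N + 1\<close> into the permutations of \<open>{1..N}\<close> gives
  \<open>R (N + 1) = (N + 1) R N + (1 - t) (R N)'\<close> for even \<open>N\<close> and
  \<open>R (N + 1) = (1 + N t) R N + t (1 - t) (R N)'\<close> for odd \<open>N\<close>. At a negative zero of \<open>R N\<close> the
  sign of \<open>R (N + 1)\<close> is therefore that of the derivative of \<open>R N\<close>, or its opposite, so the signs
  alternate along the zeros of \<open>R N\<close>. Together with the signs at \<open>0\<close> and at minus infinity, the
  intermediate value theorem yields as many negative zeros as the degree \<open>\<lfloor>(N + 1) / 2\<rfloor>\<close>
  of \<open>R (N + 1)\<close>, separated by the zeros of \<open>R N\<close>.\<close>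

section \<open>Real polynomials with simple negative zeros\<close>

text \<open>Since \<open>n\<close> is the degree, the strictly increasing list \<open>x 0\<close>,
  ..., \<open>x (n - 1)\<close> exhausts the zeros and forces them to be simple. The order makes
  signs readable from the index, and the positive leading coefficient normalises them. Values of
  \<open>x\<close> from \<open>n\<close> on are arbitrary.\<close>

definition negative_root_seq :: "real poly \<Rightarrow> nat \<Rightarrow> (nat \<Rightarrow> real) \<Rightarrow> bool" where
  "negative_root_seq p n x \<longleftrightarrow> degree p = n \<and> lead_coeff p > 0 \<and>
     (\<forall>i<n. x i < 0 \<and> poly p (x i) = 0) \<and> strict_mono_on {..<n} x"

lemma negative_root_seqD:
  assumes "negative_root_seq p n x"
  shows "degree p = n" "lead_coeff p > 0" "p \<noteq> 0"
    "\<And>i. i < n \<Longrightarrow> x i < 0" "\<And>i. i < n \<Longrightarrow> poly p (x i) = 0"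
    "\<And>i j. i < j \<Longrightarrow> j < n \<Longrightarrow> x i < x j" "inj_on x {..<n}"
proof -
  show "inj_on x {..<n}"
    using assms by (auto simp: negative_root_seq_def intro: strict_mono_on_imp_inj_on)
qed (use assms in \<open>auto simp: negative_root_seq_def strict_mono_on_def\<close>)

text \<open>Both sides have degree at most \<open>n\<close>, the same coefficient at
  \<open>n\<close>, and the \<open>n\<close> distinct points \<open>x i\<close> as common zeros, so
  they coincide.\<close>

lemma negative_root_seq_factorization:
  assumes "negative_root_seq p n x"
  shows "p = smult (lead_coeff p) (\<Prod>i<n. [:- x i, 1:])"
proof (rule poly_eqI_degree_lead_coeff[where n = n and A = "x ` {..<n}"])
  note D = negative_root_seqD[OF assms]
  have deg: "degree (\<Prod>i<n. [:- x i, 1:]) = n"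
    by (subst degree_prod_eq_sum_degree) auto
  moreover have "lead_coeff (\<Prod>i<n. [:- x i, 1:]) = 1"
    by (subst lead_coeff_prod) simp
  ultimately show "coeff p n = coeff (smult (lead_coeff p) (\<Prod>i<n. [:- x i, 1:])) n"
    using D(1) by simp
  show "degree (smult (lead_coeff p) (\<Prod>i<n. [:- x i, 1:])) \<le> n"
    using deg by simp
  show "card (x ` {..<n}) \<ge> n" "degree p \<le> n"
    using D(1,7) by (auto simp: card_image)
  show "poly p z = poly (smult (lead_coeff p) (\<Prod>i<n. [:- x i, 1:])) z"
    if "z \<in> x ` {..<n}" for z
    using that D(5) by (auto simp: poly_prod)
qed

text \<open>At \<open>x i\<close> only the summand of the product rule that differentiates the
  factor of \<open>x i\<close> survives. Of the remaining factors \<open>x i - x j\<close>, exactly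
  the \<open>n - Suc i\<close> with \<open>j > i\<close> are negative.\<close>

lemma negative_root_seq_pderiv_sign:
  assumes "negative_root_seq p n x" "i < n"
  shows "(- 1) ^ (n - Suc i) * poly (pderiv p) (x i) > 0"
proof -
  note D = negative_root_seqD[OF assms(1)]
  have "poly (pderiv p) (x i) = lead_coeff p * (\<Prod>j\<in>{..<n} - {i}. x i - x j)"
    using assms(2)
    by (subst negative_root_seq_factorization[OF assms(1)], subst prod.remove[of _ i])
       (simp_all add: pderiv_smult pderiv_mult pderiv_pCons poly_prod del: mult_pCons_left)
  also have "{..<n} - {i} = {..<i} \<union> {Suc i..<n}"
    using assms(2) by auto
  also have "(\<Prod>j\<in>{..<i} \<union> {Suc i..<n}. x i - x j) =
      (\<Prod>j<i. x i - x j) * (\<Prod>j=Suc i..<n. x i - x j)"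
    by (rule prod.union_disjoint) auto
  also have "(\<Prod>j=Suc i..<n. x i - x j) = (\<Prod>j=Suc i..<n. (- 1) * (x j - x i))"
    by simp
  also have "\<dots> = (- 1) ^ (n - Suc i) * (\<Prod>j=Suc i..<n. x j - x i)"
    by (subst prod.distrib) simp
  finally have "(- 1) ^ (n - Suc i) * poly (pderiv p) (x i) =
      lead_coeff p * ((\<Prod>j<i. x i - x j) * (\<Prod>j=Suc i..<n. x j - x i))"
    by (simp flip: power_mult_distrib)
  also have "\<dots> > 0"
    using D(2,6) assms(2) by (intro mult_pos_pos prod_pos) auto
  finally show ?thesis .
qed

lemma negative_root_seq_real_zeros:
  assumes "negative_root_seq p n x"
  shows "real_zeros p = x ` {..<n}"
proof -
  note D = negative_root_seqD[OF assms]
  have "poly p z = 0 \<Longrightarrow> z \<in> x ` {..<n}" for z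
    by (subst (asm) negative_root_seq_factorization[OF assms]) (use D(3) in \<open>auto simp: poly_prod\<close>)
  then show ?thesis
    using D(5) by (auto simp: real_zeros_def)
qed

lemma poly_of_real_map_poly:
  "poly (map_poly of_real p) (of_real x :: 'a :: {real_algebra_1, comm_ring_1}) = of_real (poly p x)"
  by (induction p) (auto simp: map_poly_pCons)

lemma pderiv_map_poly_of_real:
  "pderiv (map_poly of_real p :: 'a :: {real_div_algebra, idom} poly) = map_poly of_real (pderiv p)"
  by (rule poly_eqI) (simp add: coeff_pderiv coeff_map_poly)

lemma order_eq_1:
  fixes p :: "'a :: {idom, semiring_char_0} poly"
  assumes "poly p a = 0" "poly (pderiv p) a \<noteq> 0"
  shows "order a p = 1"
  using assms order_pderiv[of p a] order_0I[of "pderiv p" a] by fastforce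

text \<open>The degree bounds the number of complex zeros by \<open>n\<close>, and the
  \<open>n\<close> distinct real zeros already reach this bound, so no non-real zero is
  left.\<close>

lemma negative_root_seq_complex_zeros:
  assumes "negative_root_seq p n x"
  shows "{z. poly (complex_poly p) z = 0} = complex_of_real ` x ` {..<n}"
proof (rule sym, rule card_subset_eq)
  note D = negative_root_seqD[OF assms]
  have nz: "complex_poly p \<noteq> 0"
    using D(3) by (simp add: map_poly_eq_0_iff)
  then show "finite {z. poly (complex_poly p) z = 0}"
    by (rule poly_roots_finite)
  show sub: "complex_of_real ` x ` {..<n} \<subseteq> {z. poly (complex_poly p) z = 0}"
    using D(5) by (auto simp: poly_of_real_map_poly)
  have "card (complex_of_real ` x ` {..<n}) = n"
    using D(7) by (simp add: card_image inj_on_def)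
  moreover have "card {z. poly (complex_poly p) z = 0} \<le> n"
    using card_poly_roots_bound[OF nz] D(1) by (simp add: degree_map_poly)
  moreover have "card (complex_of_real ` x ` {..<n}) \<le> card {z. poly (complex_poly p) z = 0}"
    by (rule card_mono) (use sub nz poly_roots_finite in auto)
  ultimately show "card (complex_of_real ` x ` {..<n}) = card {z. poly (complex_poly p) z = 0}"
    by simp
qed

lemma negative_root_seq_order:
  assumes "negative_root_seq p n x" "i < n"
  shows "order (x i) p = 1" "order (complex_of_real (x i)) (complex_poly p) = 1"
proof -
  note D = negative_root_seqD[OF assms(1)]
  have "poly (pderiv p) (x i) \<noteq> 0"
    using negative_root_seq_pderiv_sign[OF assms] by auto
  then show "order (x i) p = 1" "order (complex_of_real (x i)) (complex_poly p) = 1"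
    using D(5)[OF assms(2)]
    by (intro order_eq_1; simp add: poly_of_real_map_poly pderiv_map_poly_of_real)+
qed

lemma negative_root_seq_imp_only_simple_negative_zeros:
  assumes "negative_root_seq p n x"
  shows "only_simple_negative_zeros p"
  unfolding only_simple_negative_zeros_def
proof (intro conjI allI impI)
  show "p \<noteq> 0"
    by (rule negative_root_seqD(3)[OF assms])
  fix z assume "poly (complex_poly p) z = 0"
  then obtain i where i: "i < n" "z = complex_of_real (x i)"
    using negative_root_seq_complex_zeros[OF assms] by blast
  then show "z \<in> \<real>" "Re z < 0"
    using negative_root_seqD(4)[OF assms] by auto
  show "order z (complex_poly p) = 1"
    unfolding i(2) by (rule negative_root_seq_order(2)[OF assms i(1)])
qed

section \<open>Interlacing\<close>

text \<open>If two neighbours in the sorted list were zeros of the same polynomial, a zero of the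
  other one would lie strictly between them and would have to appear in the list.\<close>

lemma alternating_zerosI:
  assumes "finite (real_zeros p)" "finite (real_zeros q)"
    and pq: "\<And>a b. a \<in> real_zeros p \<Longrightarrow> b \<in> real_zeros p \<Longrightarrow> a < b \<Longrightarrow> \<exists>c\<in>real_zeros q. a < c \<and> c < b"
    and qp: "\<And>a b. a \<in> real_zeros q \<Longrightarrow> b \<in> real_zeros q \<Longrightarrow> a < b \<Longrightarrow> \<exists>c\<in>real_zeros p. a < c \<and> c < b"
  shows "alternating_zeros p q"
proof -
  define Z where "Z = real_zeros p \<union> real_zeros q"
  define xs where "xs = sorted_list_of_set Z"
  have xs: "set xs = Z" "sorted_wrt (<) xs"
    using assms(1,2) by (auto simp: xs_def Z_def)
  have "(xs ! i \<in> real_zeros p \<and> xs ! Suc i \<in> real_zeros q) \<or>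
        (xs ! i \<in> real_zeros q \<and> xs ! Suc i \<in> real_zeros p)" if i: "Suc i < length xs" for i
  proof -
    have lt: "xs ! i < xs ! Suc i"
      using sorted_wrt_nth_less[OF xs(2)] i by blast
    have gap: "\<not> (xs ! i < c \<and> c < xs ! Suc i)" if "c \<in> Z" for c
    proof
      assume c: "xs ! i < c \<and> c < xs ! Suc i"
      obtain k where k: "k < length xs" "xs ! k = c"
        using \<open>c \<in> Z\<close> xs(1) by (metis in_set_conv_nth)
      have "k \<le> i \<or> Suc i \<le> k" by linarith
      then have "xs ! k \<le> xs ! i \<or> xs ! Suc i \<le> xs ! k"
        using sorted_wrt_nth_less[OF xs(2)] i k(1)
        by (metis Suc_lessD nle_le order_le_less)
      with c k(2) show False by auto
    qed
    have "xs ! i \<in> Z" "xs ! Suc i \<in> Z"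
      using i xs(1) nth_mem by (metis Suc_lessD)+
    then show ?thesis
      using lt gap pq[of "xs ! i" "xs ! Suc i"] qp[of "xs ! i" "xs ! Suc i"] unfolding Z_def by blast
  qed
  then show ?thesis
    by (simp add: alternating_zeros_def Let_def xs_def Z_def)
qed

text \<open>The pattern is \<open>y 0 < x 0 < y 1 < x 1 < ...\<close>, starting with
  \<open>y\<close>. It ends with an \<open>x\<close> if \<open>m = n > 0\<close> and with a
  \<open>y\<close> if \<open>m = Suc n\<close>; these are the cases of even and odd \<open>N\<close>
  below.\<close>

definition interlacing_seqs :: "nat \<Rightarrow> (nat \<Rightarrow> real) \<Rightarrow> nat \<Rightarrow> (nat \<Rightarrow> real) \<Rightarrow> bool" where
  "interlacing_seqs n x m y \<longleftrightarrow> n \<le> m \<and> m \<le> Suc n \<and>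
     (\<forall>i<n. y i < x i) \<and> (\<forall>i<n. Suc i < m \<longrightarrow> x i < y (Suc i))"

lemma interlacing_seqs_imp_strictly_interlace:
  assumes p: "negative_root_seq p n x" and q: "negative_root_seq q m y"
    and int: "interlacing_seqs n x m y"
  shows "strictly_interlace p q"
  unfolding strictly_interlace_def
proof (intro conjI)
  note P = negative_root_seqD[OF p] and Q = negative_root_seqD[OF q]
  note zp = negative_root_seq_real_zeros[OF p] and zq = negative_root_seq_real_zeros[OF q]
  have nm: "n \<le> m" "m \<le> Suc n"
    and yx: "\<And>i. i < n \<Longrightarrow> y i < x i" and xy: "\<And>i. i < n \<Longrightarrow> Suc i < m \<Longrightarrow> x i < y (Suc i)"
    using int by (auto simp: interlacing_seqs_def)
  show "real_rooted p" "real_rooted q"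
    using negative_root_seq_imp_only_simple_negative_zeros[OF p]
      negative_root_seq_imp_only_simple_negative_zeros[OF q]
    by (auto simp: only_simple_negative_zeros_def real_rooted_def)
  show "degree p \<le> degree q + 1" "degree q \<le> degree p + 1"
    using P(1) Q(1) nm by auto
  show "\<forall>x\<in>real_zeros p. order x p = 1" "\<forall>x\<in>real_zeros q. order x q = 1"
    using negative_root_seq_order(1)[OF p] negative_root_seq_order(1)[OF q] zp zq by auto
  \<comment> \<open>For \<open>j \<le> i\<close> the zero \<open>y j\<close> lies left of
    \<open>x i\<close>, for \<open>j > i\<close> it lies right of it.\<close>
  have "x i \<noteq> y j" if "i < n" "j < m" for i j
  proof (cases "j \<le> i")
    case True
    then have "y j \<le> y i"
      using Q(6)[of j i] that nm by (cases "j = i") auto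
    then show ?thesis using yx[of i] that by auto
  next
    case False
    then have "y (Suc i) \<le> y j"
      using Q(6)[of "Suc i" j] that by (cases "j = Suc i") auto
    then show ?thesis using xy[of i] that False by auto
  qed
  then show "real_zeros p \<inter> real_zeros q = {}"
    using zp zq by auto
  show "alternating_zeros p q"
  proof (rule alternating_zerosI)
    show "finite (real_zeros p)" "finite (real_zeros q)"
      using zp zq by auto
  next
    fix a b assume "a \<in> real_zeros p" "b \<in> real_zeros p" "a < b"
    then obtain i j where ij: "a = x i" "b = x j" "i < n" "j < n"
      using zp by auto
    have "i < j"
      using \<open>a < b\<close> ij P(6)[of j i] by (cases i j rule: linorder_cases) auto
    have "x i < y (Suc i)" "y (Suc i) \<le> y j" "y j < x j"
      using xy[of i] yx[of j] ij \<open>i < j\<close> nm Q(6)[of "Suc i" j] by (cases "j = Suc i"; auto)+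
    then show "\<exists>c\<in>real_zeros q. a < c \<and> c < b"
      using ij zq nm by (intro bexI[of _ "y j"]) auto
  next
    fix a b assume "a \<in> real_zeros q" "b \<in> real_zeros q" "a < b"
    then obtain i j where ij: "a = y i" "b = y j" "i < m" "j < m"
      using zq by auto
    have "i < j"
      using \<open>a < b\<close> ij Q(6)[of j i] by (cases i j rule: linorder_cases) auto
    then have "i < n" using ij nm by simp
    have "y i < x i" "x i < y (Suc i)" "y (Suc i) \<le> y j"
      using xy[of i] yx[of i] ij \<open>i < j\<close> \<open>i < n\<close> Q(6)[of "Suc i" j] by (cases "j = Suc i"; auto)+
    then show "\<exists>c\<in>real_zeros p. a < c \<and> c < b"
      using ij zp \<open>i < n\<close> by (intro bexI[of _ "x i"]) auto
  qed
qed

section \<open>Zeros from sign changes\<close>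

lemma poly_sign_at_minus_infinity:
  fixes q :: "real poly"
  assumes "lead_coeff q > 0"
  shows "\<exists>u<b. (- 1) ^ degree q * poly q u > 0"
proof -
  \<comment> \<open>Reflection at the origin moves minus infinity to plus infinity, and the factor
    \<open>(- 1) ^ degree q\<close> restores the leading coefficient of \<open>q\<close>.\<close>
  define r where "r = smult ((- 1) ^ degree q) (pcompose q [:0, -1:])"
  have "lead_coeff r = lead_coeff q"
    by (simp add: r_def lead_coeff_comp flip: power_mult_distrib)
  then obtain c where c: "\<And>x. x \<ge> c \<Longrightarrow> poly r x \<ge> lead_coeff q"
    using poly_pinfty_gt_lc[of r] assms by auto
  \<comment> \<open>The bound \<open>c\<close> makes \<open>r\<close> positive at \<open>t\<close>,
    and \<open>1 - b\<close> ensures \<open>- t < b\<close>.\<close>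
  define t where "t = max c (1 - b)"
  have "poly r t > 0"
    using c[of t] assms by (simp add: t_def)
  then show ?thesis
    by (intro exI[of _ "- t"]) (auto simp: r_def poly_pcompose t_def)
qed

text \<open>The \<open>m + 1\<close> sample points bound \<open>m\<close> gaps with a sign change in
  each, so the intermediate value theorem yields \<open>m\<close> zeros, as many as the degree. They
  lie strictly left of \<open>u m\<close>, so \<open>u m = 0\<close> is allowed.\<close>

lemma negative_root_seq_of_alternating_signs:
  assumes "degree q = m" "lead_coeff q > 0"
    and u: "\<And>i. i < m \<Longrightarrow> u i < u (Suc i)" "u m \<le> 0"
    and sgn: "\<And>i. i \<le> m \<Longrightarrow> (- 1) ^ (m - i) * poly q (u i) > 0"
  shows "\<exists>z. negative_root_seq q m z \<and> (\<forall>i<m. u i < z i \<and> z i < u (Suc i))"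
proof -
  have "\<exists>z. u i < z \<and> z < u (Suc i) \<and> poly q z = 0" if "i < m" for i
  proof -
    have "m - i = Suc (m - Suc i)" using that by simp
    then have "poly q (u i) * poly q (u (Suc i)) < 0"
      using sgn[of i] sgn[of "Suc i"] that
      by (cases "even (m - Suc i)") (auto simp: mult_less_0_iff)
    then show ?thesis
      using poly_IVT[of "u i" "u (Suc i)" q] u(1)[OF that] by auto
  qed
  then obtain z where z: "\<And>i. i < m \<Longrightarrow> u i < z i \<and> z i < u (Suc i) \<and> poly q (z i) = 0"
    by metis
  have mono: "u i \<le> u j" if "i \<le> j" "j \<le> m" for i j
    using that
  proof (induction j rule: dec_induct)
    case (step k)
    then show ?case using u(1)[of k] by simp
  qed simp
  have "z i < 0" if "i < m" for i
    using z[OF that] mono[of "Suc i" m] u(2) that by simp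
  moreover have "z i < z j" if "i < j" "j < m" for i j
    using z[of i] z[of j] mono[of "Suc i" j] that by simp
  ultimately have "negative_root_seq q m z"
    using assms(1,2) z by (auto simp: negative_root_seq_def strict_mono_on_def)
  with z show ?thesis by blast
qed

lemma interlacing_step:
  assumes p: "negative_root_seq p n x" and q: "degree q = m" "lead_coeff q > 0" "poly q 0 > 0"
    and nm: "n \<le> m" "m \<le> Suc n"
    and sgn: "\<And>i. i < n \<Longrightarrow> (- 1) ^ (m - Suc i) * poly q (x i) > 0"
  shows "\<exists>y. negative_root_seq q m y \<and> interlacing_seqs n x m y"
proof -
  note P = negative_root_seqD[OF p]
  \<comment> \<open>For \<open>n = 0\<close> the value \<open>x 0\<close> is arbitrary; the minimum
    with \<open>0\<close> still keeps \<open>a\<close> negative.\<close>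
  obtain a where a: "a < min (x 0) 0" "(- 1) ^ m * poly q a > 0"
    using poly_sign_at_minus_infinity[OF q(2)] q(1) by blast
  \<comment> \<open>The sample points are \<open>a, x 0, ..., x (n - 1), 0\<close>. The last one
    used, \<open>u m\<close>, is \<open>0\<close> if \<open>m = Suc n\<close> and
    \<open>x (n - 1)\<close> if \<open>m = n > 0\<close>.\<close>
  define u where "u = case_nat a (\<lambda>i. if i < n then x i else 0)"
  have "\<exists>y. negative_root_seq q m y \<and> (\<forall>i<m. u i < y i \<and> y i < u (Suc i))"
  proof (rule negative_root_seq_of_alternating_signs)
    show "u i < u (Suc i)" if "i < m" for i
      using that a(1) P(4,6) nm by (cases i) (auto simp: u_def)
    show "u m \<le> 0"
      using a(1) P(4) nm by (cases m) (auto simp: u_def intro: less_imp_le)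
    show "(- 1) ^ (m - i) * poly q (u i) > 0" if "i \<le> m" for i
      using that a(2) q(3) nm sgn by (cases i) (auto simp: u_def)
  qed (use q in auto)
  then obtain y where y: "negative_root_seq q m y" "\<And>i. i < m \<Longrightarrow> u i < y i \<and> y i < u (Suc i)"
    by blast
  have "interlacing_seqs n x m y"
    unfolding interlacing_seqs_def
  proof (intro conjI allI impI nm)
    show "y i < x i" if "i < n" for i
      using y(2)[of i] that nm by (simp add: u_def)
    show "x i < y (Suc i)" if "i < n" "Suc i < m" for i
      using y(2)[of "Suc i"] that by (simp add: u_def)
  qed
  with y(1) show ?thesis by blast
qed

section \<open>Insertion of the largest value\<close>

text \<open>This is a cycle on positions. As a permutation \<open>\<pi>\<close> of
  \<open>{1..N}\<close> fixes \<open>Suc N\<close>, the word of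
  \<open>\<pi> \<circ> insert_cycle N k\<close> is that of \<open>\<pi>\<close> with
  \<open>Suc N\<close> inserted after its first \<open>k\<close> entries.\<close>

definition insert_cycle :: "nat \<Rightarrow> nat \<Rightarrow> nat \<Rightarrow> nat" where
  "insert_cycle N k i =
     (if i = Suc k then Suc N else if Suc k < i \<and> i \<le> Suc N then i - 1 else i)"

lemma insert_cycle_permutes:
  assumes "k \<le> N"
  shows "insert_cycle N k permutes {1..Suc N}"
proof (rule inj_imp_permutes)
  show "inj_on (insert_cycle N k) {1..Suc N}"
    using assms by (auto simp: inj_on_def insert_cycle_def split: if_splits)
qed (use assms in \<open>auto simp: insert_cycle_def\<close>)

text \<open>The place \<open>k\<close> is recovered from the position of the value
  \<open>Suc N\<close>, and then \<open>\<pi>\<close> by cancelling the cycle. Surjectivity follows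
  by counting, since there are \<open>N + 1\<close> places for each of the \<open>N!\<close>
  permutations.\<close>

lemma permutes_insert_bij_betw:
  "bij_betw (\<lambda>(\<pi>, k). \<pi> \<circ> insert_cycle N k) ({\<pi>. \<pi> permutes {1..N}} \<times> {..N})
     {\<pi>. \<pi> permutes {1..Suc N}}"
proof -
  let ?f = "\<lambda>(\<pi>, k). \<pi> \<circ> insert_cycle N k" and ?A = "{\<pi>. \<pi> permutes {1..N}} \<times> {..N}"
  have "inj_on ?f ?A"
  proof (rule inj_onI, clarify)
    fix \<pi> \<rho> :: "nat \<Rightarrow> nat" and k l
    assume pr: "\<pi> permutes {1..N}" "\<rho> permutes {1..N}" and kl: "k \<le> N" "l \<le> N"
      and eq: "\<pi> \<circ> insert_cycle N k = \<rho> \<circ> insert_cycle N l"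
    have fixed: "\<pi> (Suc N) = Suc N" "\<rho> (Suc N) = Suc N"
      using pr by (auto simp: permutes_def)
    have "\<rho> (insert_cycle N l (Suc k)) = \<pi> (insert_cycle N k (Suc k))"
      using eq by (metis comp_apply)
    also have "\<dots> = \<rho> (Suc N)"
      by (simp add: insert_cycle_def fixed)
    finally have "insert_cycle N l (Suc k) = Suc N"
      using permutes_inj[OF pr(2)] by (simp add: inj_eq)
    then have "k = l"
      using kl by (auto simp: insert_cycle_def split: if_splits)
    moreover have "\<pi> = \<rho>"
    proof
      fix i
      obtain j where "i = insert_cycle N k j"
        using permutes_surj[OF insert_cycle_permutes[OF kl(1)]] by (metis surj_def)
      then show "\<pi> i = \<rho> i"
        using eq \<open>k = l\<close> by (metis comp_apply)
    qed
    ultimately show "\<pi> = \<rho> \<and> k = l" by simp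
  qed
  moreover have "?f ` ?A = {\<pi>. \<pi> permutes {1..Suc N}}"
  proof (rule card_subset_eq)
    show "finite {\<pi>. \<pi> permutes {1..Suc N}}"
      by (rule finite_permutations) simp
    show "?f ` ?A \<subseteq> {\<pi>. \<pi> permutes {1..Suc N}}"
    proof (rule image_subsetI)
      fix a assume "a \<in> ?A"
      then obtain \<pi> k where a: "a = (\<pi>, k)" and "\<pi> permutes {1..N}" "k \<in> {..N}"
        by auto
      then have "\<pi> permutes {1..Suc N}" "insert_cycle N k permutes {1..Suc N}"
        using permutes_subset[of \<pi> "{1..N}" "{1..Suc N}"] insert_cycle_permutes by auto
      then show "?f a \<in> {\<pi>. \<pi> permutes {1..Suc N}}"
        using permutes_compose by (simp add: a)
    qed
    show "card (?f ` ?A) = card {\<pi>. \<pi> permutes {1..Suc N}}"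
      using \<open>inj_on ?f ?A\<close>
      by (simp add: card_image card_cartesian_product card_permutations algebra_simps)
  qed
  ultimately show ?thesis by (simp add: bij_betw_def)
qed

lemma finite_even_top_descents [simp]: "finite (even_top_descents N \<pi>)"
  by (rule finite_subset[of _ "{..<N}"]) (auto simp: even_top_descents_def)

lemma even_top_descents_subset: "even_top_descents N \<pi> \<subseteq> {1..<N}"
  by (auto simp: even_top_descents_def)

text \<open>Placing \<open>N + 1\<close> between positions \<open>k\<close> and \<open>k + 1\<close> destroys a descent at \<open>k\<close>, and creates
  the descent \<open>k + 1\<close>, whose top \<open>N + 1\<close> counts only if it is even.\<close>

lemma even_top_descents_insert:
  assumes "\<pi> permutes {1..N}" "k \<le> N"
  shows "even_top_descents (Suc N) (\<pi> \<circ> insert_cycle N k) =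
      {i \<in> even_top_descents N \<pi>. i < k} \<union> Suc ` {i \<in> even_top_descents N \<pi>. k < i} \<union>
      (if k < N \<and> odd N then {Suc k} else {})" (is "?L = ?R")
proof (rule set_eqI)
  fix i
  have fixed: "\<pi> (Suc N) = Suc N"
    using assms(1) by (auto simp: permutes_def)
  have le: "\<pi> j \<le> N" if "1 \<le> j" "j \<le> N" for j
    using permutes_in_image[OF assms(1), of j] that by auto
  consider "i < k" | "i = k" | "i = Suc k" | j where "i = Suc j" "k < j"
    by (metis Suc_lessI lessE linorder_neqE_nat)
  then show "i \<in> ?L \<longleftrightarrow> i \<in> ?R"
  proof cases
    case 1
    then show ?thesis
      using assms(2) by (auto simp: even_top_descents_def insert_cycle_def)
  next
    case 2
    then show ?thesis
      using assms(2) le[of k] fixed by (auto simp: even_top_descents_def insert_cycle_def)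
  next
    case 3
    then show ?thesis
      using assms(2) le[of "Suc k"] fixed
      by (auto simp: even_top_descents_def insert_cycle_def less_Suc_eq_le)
  next
    case 4
    then show ?thesis
      using assms(2) by (auto simp: even_top_descents_def insert_cycle_def)
  qed
qed

lemma card_even_top_descents_insert:
  assumes "\<pi> permutes {1..N}" "k \<le> N"
  shows "card (even_top_descents (Suc N) (\<pi> \<circ> insert_cycle N k)) =
      card (even_top_descents N \<pi> - {k}) + (if k < N \<and> odd N then 1 else 0)"
proof -
  let ?D = "even_top_descents N \<pi>"
  let ?A = "{i \<in> ?D. i < k}" and ?B = "{i \<in> ?D. k < i}"
  have "card (?A \<union> Suc ` ?B \<union> (if k < N \<and> odd N then {Suc k} else {})) =
      card (?A \<union> Suc ` ?B) + card (if k < N \<and> odd N then {Suc k} else {})"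
    by (rule card_Un_disjoint) auto
  also have "card (?A \<union> Suc ` ?B) = card ?A + card (Suc ` ?B)"
    by (rule card_Un_disjoint) auto
  also have "card (Suc ` ?B) = card ?B"
    by (simp add: card_image)
  also have "card ?A + card ?B = card (?A \<union> ?B)"
    by (rule card_Un_disjoint[symmetric]) auto
  also have "?A \<union> ?B = ?D - {k}" by auto
  finally show ?thesis
    by (simp add: even_top_descents_insert[OF assms])
qed

section \<open>Recurrences for the polynomials\<close>

lemma R_Suc:
  "R (Suc N) = (\<Sum>\<pi> | \<pi> permutes {1..N}. \<Sum>k\<le>N.
     monom 1 (card (even_top_descents N \<pi> - {k}) + (if k < N \<and> odd N then 1 else 0)))"
proof -
  let ?g = "\<lambda>\<pi>. monom (1::real) (card (even_top_descents (Suc N) \<pi>))"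
  have "R (Suc N) =
      (\<Sum>(\<pi>, k)\<in>{\<pi>. \<pi> permutes {1..N}} \<times> {..N}. ?g (\<pi> \<circ> insert_cycle N k))"
    unfolding R_def
    by (subst sum.reindex_bij_betw[OF permutes_insert_bij_betw, symmetric])
       (simp add: case_prod_unfold)
  also have "\<dots> = (\<Sum>\<pi> | \<pi> permutes {1..N}. \<Sum>k\<le>N. ?g (\<pi> \<circ> insert_cycle N k))"
    by (rule sum.cartesian_product[symmetric])
  finally show ?thesis
    by (simp add: card_even_top_descents_insert)
qed

lemma pderiv_R:
  "pderiv (R N) = (\<Sum>\<pi> | \<pi> permutes {1..N}.
     pderiv (monom 1 (card (even_top_descents N \<pi>))))"
  unfolding R_def by (rule higher_pderiv_sum[where n = 1, simplified])

text \<open>Each \<open>k\<close> outside \<open>D\<close> leaves the exponent unchanged. The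
  \<open>card D\<close> elements of \<open>D\<close> lower it by one, and together they give the
  derivative of the monomial.\<close>

lemma sum_monom_card_diff:
  fixes D :: "nat set"
  assumes "finite D" "finite K" "D \<subseteq> K"
  shows "(\<Sum>k\<in>K. monom (1::real) (card (D - {k}))) =
    of_nat (card K - card D) * monom 1 (card D) + pderiv (monom 1 (card D))"
proof -
  have "(\<Sum>k\<in>K. monom (1::real) (card (D - {k}))) =
      (\<Sum>k\<in>K - D. monom 1 (card (D - {k}))) + (\<Sum>k\<in>D. monom 1 (card (D - {k})))"
    using assms by (intro sum.subset_diff) auto
  also have "(\<Sum>k\<in>K - D. monom 1 (card (D - {k}))) = (\<Sum>k\<in>K - D. monom (1::real) (card D))"
    by (intro sum.cong) auto
  also have "\<dots> = of_nat (card K - card D) * monom 1 (card D)"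
    using assms by (simp add: card_Diff_subset)
  also have "(\<Sum>k\<in>D. monom 1 (card (D - {k}))) = (\<Sum>k\<in>D. monom (1::real) (card D - 1))"
    by (intro sum.cong) auto
  also have "\<dots> = pderiv (monom 1 (card D))"
    by (simp add: pderiv_monom of_nat_monom mult_monom)
  finally show ?thesis .
qed

text \<open>This trades the factor \<open>d\<close>, which varies with the permutation, for a
  differential operator that can be pulled out of the sum over all permutations.\<close>

lemma X_times_pderiv_monom:
  "[:0, 1:] * pderiv (monom c d) = of_nat d * monom (c :: 'a :: idom) d"
proof (rule poly_eqI)
  show "coeff ([:0, 1:] * pderiv (monom c d)) k = coeff (of_nat d * monom c d) k" for k
    by (cases k) (simp_all add: of_nat_poly coeff_pderiv)
qed

text \<open>The inserted top \<open>N + 1\<close> is odd, so no counted descent arises. A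
  permutation with \<open>d\<close> of them contributes \<open>(N + 1 - d) t^d + d t^(d-1)\<close>,
  and \<open>d t^d = t (t^d)'\<close> makes this linear in \<open>t^d\<close> and its
  derivative.\<close>

lemma R_Suc_even:
  assumes "even N"
  shows "R (Suc N) = of_nat (Suc N) * R N + [:1, -1:] * pderiv (R N)"
proof -
  have key: "(\<Sum>k\<le>N. monom 1 (card (even_top_descents N \<pi> - {k}))) =
      of_nat (Suc N) * monom 1 (card (even_top_descents N \<pi>)) +
      [:1, -1:] * pderiv (monom (1::real) (card (even_top_descents N \<pi>)))" for \<pi>
  proof -
    let ?D = "even_top_descents N \<pi>"
    have "?D \<subseteq> {..N}"
      using even_top_descents_subset[of N \<pi>] by auto
    moreover from this have "card ?D \<le> Suc N"
      using card_mono[of "{..N}" ?D] by simp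
    then have "(of_nat (Suc N - card ?D) :: real poly) = of_nat (Suc N) - of_nat (card ?D)"
      by (rule of_nat_diff)
    moreover have "[:1, -1:] = 1 - [:0, 1::real:]"
      by (simp add: one_pCons)
    ultimately show ?thesis
      using X_times_pderiv_monom[of "1::real" "card ?D"]
      by (simp only: sum_monom_card_diff finite_even_top_descents finite_atMost card_atMost
            left_diff_distrib mult_1_left)
  qed
  show ?thesis
    unfolding R_Suc pderiv_R unfolding R_def sum_distrib_left sum.distrib[symmetric]
    by (intro sum.cong refl) (use assms key in simp)
qed

text \<open>The inserted top \<open>N + 1\<close> is even and adds a descent at every place except
  the last, so a permutation with \<open>d\<close> of them contributes
  \<open>t ((N - d) t^d + (t^d)') + t^d\<close>.\<close>

lemma R_Suc_odd:
  assumes "odd N"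
  shows "R (Suc N) = [:1, of_nat N:] * R N + [:0, 1, -1:] * pderiv (R N)"
proof -
  have key: "(\<Sum>k\<le>N. monom 1 (card (even_top_descents N \<pi> - {k}) + (if k < N then 1 else 0))) =
      [:1, of_nat N:] * monom 1 (card (even_top_descents N \<pi>)) +
      [:0, 1, -1:] * pderiv (monom (1::real) (card (even_top_descents N \<pi>)))" for \<pi>
  proof -
    let ?D = "even_top_descents N \<pi>"
    \<comment> \<open>Used with \<open>x\<close> the indeterminate, \<open>a = N\<close>,
      \<open>b = d\<close>, \<open>m = t^d\<close> and \<open>m'\<close> its derivative.\<close>
    have ring_identity: "x * ((a - b) * m + m') + m = (1 + x * a) * m + (x - x * x) * m'"
      if "x * m' = b * m" for x a b m m' :: "real poly"
    proof -
      have "x * x * m' = x * b * m"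
        by (simp only: mult.assoc that)
      then show ?thesis
        using that by (simp add: algebra_simps)
    qed
    have D: "?D \<subseteq> {..<N}"
      using even_top_descents_subset[of N \<pi>] by auto
    then have c: "card ?D \<le> N"
      using card_mono[of "{..<N}" ?D] by simp
    \<comment> \<open>The place \<open>k = N\<close> at the end of the word is split off: it creates
      no descent, and it destroys none because \<open>N\<close> is not a descent position.\<close>
    have "(\<Sum>k\<le>N. monom 1 (card (?D - {k}) + (if k < N then 1 else 0))) =
        (\<Sum>k<N. monom 1 (card (?D - {k}) + 1)) + monom (1::real) (card (?D - {N}))"
      by (simp flip: lessThan_Suc_atMost)
    also have "?D - {N} = ?D" using D by auto
    also have "(\<Sum>k<N. monom 1 (card (?D - {k}) + 1)) =
        [:0, 1:] * (\<Sum>k<N. monom (1::real) (card (?D - {k})))"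
      by (simp add: sum_distrib_left monom_Suc)
    also have "(\<Sum>k<N. monom (1::real) (card (?D - {k}))) =
        (of_nat N - of_nat (card ?D)) * monom 1 (card ?D) + pderiv (monom 1 (card ?D))"
      using D by (subst sum_monom_card_diff) (simp_all only: finite_even_top_descents
        finite_lessThan card_lessThan of_nat_diff[OF c])
    also have "[:0, 1:] * \<dots> + monom 1 (card ?D) =
        (1 + [:0, 1:] * of_nat N) * monom 1 (card ?D) +
        ([:0, 1:] - [:0, 1:] * [:0, 1:]) * pderiv (monom 1 (card ?D))"
      by (rule ring_identity) (rule X_times_pderiv_monom)
    also have "1 + [:0, 1:] * of_nat N = [:1, real N:]"
      by (simp add: of_nat_poly one_pCons)
    also have "[:0, 1:] - [:0, 1:] * [:0, 1:] = [:0, 1, - 1 :: real:]"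
      by simp
    finally show ?thesis .
  qed
  show ?thesis
    unfolding R_Suc pderiv_R unfolding R_def sum_distrib_left sum.distrib[symmetric]
    by (intro sum.cong refl) (use assms key in simp)
qed

section \<open>Interlacing of consecutive polynomials\<close>

lemma negative_root_seq_poly_0_pos:
  assumes "negative_root_seq p n x"
  shows "poly p 0 > 0"
proof -
  note D = negative_root_seqD[OF assms]
  have "(\<Prod>i<n. - x i) > 0"
    using D(4) by (intro prod_pos) auto
  then show ?thesis
    by (subst negative_root_seq_factorization[OF assms]) (use D(2) in \<open>simp add: poly_prod\<close>)
qed

lemma R_step_even:
  assumes "even N" "negative_root_seq (R N) (N div 2) x"
  shows "\<exists>y. negative_root_seq (R (Suc N)) (Suc N div 2) y \<and>
    interlacing_seqs (N div 2) x (Suc N div 2) y"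
proof (rule interlacing_step[OF assms(2)])
  define n where "n = N div 2"
  have N: "N = 2 * n" "Suc N div 2 = n"
    using assms(1) by (auto simp: n_def)
  have x: "negative_root_seq (R N) n x"
    using assms(2) by (simp add: n_def)
  note D = negative_root_seqD[OF x]
  have co: "coeff (R (Suc N)) k =
      (real (Suc N) - real k) * coeff (R N) k + real (Suc k) * coeff (R N) (Suc k)" for k
    by (cases k) (simp_all add: R_Suc_even[OF assms(1)] of_nat_poly coeff_pderiv algebra_simps)
  \<comment> \<open>The coefficient of \<open>R N\<close> at \<open>Suc n\<close> vanishes, so the
    degree stays \<open>n\<close> and the top coefficient remains positive.\<close>
  have "coeff (R (Suc N)) n = (real (Suc N) - real n) * lead_coeff (R N)"
    using D(1) by (simp add: co coeff_eq_0)
  then have pos: "coeff (R (Suc N)) n > 0"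
    using D(2) N(1) by simp
  show deg: "degree (R (Suc N)) = Suc N div 2"
    unfolding N(2) using pos D(1)
    by (intro antisym degree_le le_degree) (auto simp: co coeff_eq_0)
  then show "lead_coeff (R (Suc N)) > 0"
    using pos N(2) by simp
  \<comment> \<open>The recurrence gives \<open>N + 1\<close> times the constant coefficient of
    \<open>R N\<close> plus its linear one. The former is positive, and the latter is nonnegative
    because it counts permutations.\<close>
  show "poly (R (Suc N)) 0 > 0"
  proof -
    have "coeff (R N) k \<ge> 0" for k
      by (auto simp: R_def coeff_sum intro!: sum_nonneg)
    moreover have "coeff (R N) 0 > 0"
      using negative_root_seq_poly_0_pos[OF x] by (simp add: poly_0_coeff_0)
    ultimately have "coeff (R (Suc N)) 0 > 0"
      by (simp add: co add_pos_nonneg)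
    then show ?thesis by (simp add: poly_0_coeff_0)
  qed
  show "(- 1) ^ (Suc N div 2 - Suc i) * poly (R (Suc N)) (x i) > 0" if "i < N div 2" for i
  proof -
    have i: "i < n" using that by (simp add: n_def)
    have "(- 1) ^ (n - Suc i) * poly (R (Suc N)) (x i) =
        (1 - x i) * ((- 1) ^ (n - Suc i) * poly (pderiv (R N)) (x i))"
      using D(5)[OF i] by (simp add: R_Suc_even[OF assms(1)] algebra_simps)
    also have "\<dots> > 0"
      using D(4)[OF i]
      by (intro mult_pos_pos[OF _ negative_root_seq_pderiv_sign[OF x i]]) (simp add: mult_neg_pos)
    finally show ?thesis by (simp add: N(2))
  qed
qed (use assms(1) in auto)

lemma R_step_odd:
  assumes "odd N" "negative_root_seq (R N) (N div 2) x"
  shows "\<exists>y. negative_root_seq (R (Suc N)) (Suc N div 2) y \<and>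
    interlacing_seqs (N div 2) x (Suc N div 2) y"
proof (rule interlacing_step[OF assms(2)])
  define n where "n = N div 2"
  have N: "N = Suc (2 * n)" "Suc N div 2 = Suc n"
    using assms(1) by (auto simp: n_def elim!: oddE)
  have x: "negative_root_seq (R N) n x"
    using assms(2) by (simp add: n_def)
  note D = negative_root_seqD[OF x]
  have co: "coeff (R (Suc N)) (Suc k) =
      real (Suc (Suc k)) * coeff (R N) (Suc k) + (real N - real k) * coeff (R N) k" for k
    by (cases k) (simp_all add: R_Suc_odd[OF assms(1)] of_nat_poly coeff_pderiv algebra_simps)
  \<comment> \<open>Here the degree grows by one; the factor \<open>N - n\<close> equals
    \<open>n + 1\<close>.\<close>
  have "coeff (R (Suc N)) (Suc n) = (real N - real n) * lead_coeff (R N)"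
    using D(1) by (simp add: co coeff_eq_0)
  then have pos: "coeff (R (Suc N)) (Suc n) > 0"
    using D(2) N(1) by simp
  have "coeff (R (Suc N)) k = 0" if "Suc n < k" for k
    using that D(1) by (cases k) (auto simp: co coeff_eq_0)
  then show deg: "degree (R (Suc N)) = Suc N div 2"
    unfolding N(2) using pos by (intro antisym degree_le le_degree) auto
  then show "lead_coeff (R (Suc N)) > 0"
    using pos N(2) by simp
  show "poly (R (Suc N)) 0 > 0"
    using negative_root_seq_poly_0_pos[OF x] by (simp add: R_Suc_odd[OF assms(1)])
  show "(- 1) ^ (Suc N div 2 - Suc i) * poly (R (Suc N)) (x i) > 0" if "i < N div 2" for i
  proof -
    have i: "i < n" using that by (simp add: n_def)
    \<comment> \<open>The larger degree brings one more sign than the derivative of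
      \<open>R N\<close> has; it is absorbed by the negative factor \<open>x i\<close> of the
      recurrence.\<close>
    have "n - i = Suc (n - Suc i)" using i by simp
    then have "(- 1) ^ (n - i) * poly (R (Suc N)) (x i) =
        (- x i * (1 - x i)) * ((- 1) ^ (n - Suc i) * poly (pderiv (R N)) (x i))"
      using D(5)[OF i] by (simp add: R_Suc_odd[OF assms(1)] algebra_simps)
    also have "\<dots> > 0"
      using D(4)[OF i]
      by (intro mult_pos_pos[OF _ negative_root_seq_pderiv_sign[OF x i]]) (simp add: mult_neg_pos)
    finally show ?thesis by (simp add: N(2))
  qed
qed (use assms(1) in \<open>auto elim!: oddE\<close>)

lemma R_0: "R 0 = 1"
  by (simp add: R_def even_top_descents_def)

text \<open>The induction starts at the constant \<open>R 0 = 1\<close> with the empty list of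
  zeros, and the parity of \<open>N\<close> selects the step.\<close>

lemma R_negative_root_seq: "\<exists>x. negative_root_seq (R N) (N div 2) x"
proof (induction N)
  case 0
  then show ?case
    by (auto simp: negative_root_seq_def R_0)
next
  case (Suc N)
  then show ?case
    using R_step_even R_step_odd by blast
qed

theorem theorem4p1:
  fixes N :: nat
  assumes "N \<ge> 2"
  shows "only_simple_negative_zeros (R N) \<and> strictly_interlace (R N) (R (N + 1))"
proof -
  obtain x where x: "negative_root_seq (R N) (N div 2) x"
    using R_negative_root_seq by blast
  \<comment> \<open>The zeros of the next polynomial come from one more step applied to this
    \<open>x\<close>, which also supplies the interlacing.\<close>
  then obtain y where "negative_root_seq (R (Suc N)) (Suc N div 2) y"
      "interlacing_seqs (N div 2) x (Suc N div 2) y"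
    using R_step_even R_step_odd by blast
  with x show ?thesis
    using negative_root_seq_imp_only_simple_negative_zeros interlacing_seqs_imp_strictly_interlace
    by simp
qed

end
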